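(* Let $r\ge2$ and $q\ge1$ be integers with $q\le r-1$, and let $\beta<1/2$. For integers $n\ge 1$ and $m\ge r$ put $$\mathcal{Z}^{(n)}_m=\sum_{1\le i_1<\cdots<i_r\le m}\gcd\big(X^{(n)}_{i_1},\ldots,X^{(n)}_{i_r}\big)^q .$$ Then for any sequence $(n_m)$ of integers with $n_m\ge2$ and with $n_m^q\le m^\beta$ for all sufficiently large $m$, the variable $\mathcal{Z}^{(n_m)}_m$ is asymptotically normal as $m\to\infty$, that is, $$\frac{\mathcal{Z}^{(n_m)}_m-\mathbb{E}(\mathcal{Z}^{(n_m)}_m)}{\sqrt{\mathbb{V}(\mathcal{Z}^{(n_m)}_m)}}\ \xrightarrow{\ d\ }\ \mathcal{N}\qquad\text{as } m\to\infty .$$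
   Context: For each integer $n\ge1$, $X^{(n)}_1,X^{(n)}_2,\ldots$ is a sequence of independent random variables uniformly distributed in $\{1,\ldots,n\}$, defined on a probability space with probability $\mathbf{P}$; $\mathbb{E}$ and $\mathbb{V}$ denote expectation and variance. The symbol $\xrightarrow{d}$ means convergence in distribution and $\mathcal{N}$ is a standard normal variable. *)

theory Defs
  imports "HOL-Probability.Probability"
begin

definition iid_uniform :: "'a measure \<Rightarrow> nat \<Rightarrow> (nat \<Rightarrow> 'a \<Rightarrow> nat) \<Rightarrow> bool" where
  "iid_uniform M n X \<longleftrightarrow>
     prob_space M \<and>
     prob_space.indep_vars M (\<lambda>_. count_space UNIV) X {1..} \<and>
     (\<forall>i\<ge>1. distr M (count_space UNIV) (X i) = measure_pmf (pmf_of_set {1..n}))"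

text \<open>Tuples $i_1 < \dots < i_r$ of indices in $\{1,\dots,m\}$ are represented by their underlying
  \<open>r\<close>-element sets.\<close>

definition gcd_sum :: "nat \<Rightarrow> nat \<Rightarrow> (nat \<Rightarrow> 'a \<Rightarrow> nat) \<Rightarrow> nat \<Rightarrow> 'a \<Rightarrow> real" where
  "gcd_sum r q X m \<omega> = (\<Sum>I | I \<subseteq> {1..m} \<and> card I = r. real (GCD i\<in>I. X i \<omega>) ^ q)"

definition standardized :: "'a measure \<Rightarrow> ('a \<Rightarrow> real) \<Rightarrow> 'a \<Rightarrow> real" where
  "standardized M Z \<omega> =
     (Z \<omega> - prob_space.expectation M Z) / sqrt (prob_space.variance M Z)"

end

theory Submission
  imports Defs
begin

text \<open>The sum \<open>Z\<close> of \<open>gcd\<^sup>q\<close> over all \<open>r\<close>-subsets is an unnormalized U-statistic, and the theorem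
  is an instance of Hoeffding's principle that a nondegenerate U-statistic is asymptotically as
  good as its projection on sums of functions of a single variable. Write \<open>g(a)\<close> for the
  conditional mean of a kernel value given that one of its variables is \<open>a\<close>, \<open>\<theta>\<close> for the mean
  of \<open>g\<close>, \<open>\<sigma>\<^sup>2\<close> for its variance, \<open>B\<close> for a bound on the kernel and \<open>L\<close> for the sum of the
  independent variables \<open>g(X\<^sub>i) - \<theta>\<close>. Then \<open>Z - E Z = c L + R\<close> with \<open>c = (m-1 choose r-1)\<close>,
  where \<open>R\<close> is a sum of terms \<open>W\<^sub>I\<close> whose conditional mean given any one variable vanishes.

  Resampling all variables of \<open>J\<close> but one shows that \<open>W\<^sub>J\<close> is orthogonal to every variable that
  shares at most one coordinate with \<open>J\<close> (\<open>W_orthogonal\<close>). Hence \<open>R\<close> is orthogonal to \<open>L\<close>, and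
  in the second moment of \<open>R\<close> only pairs of subsets with at least two common elements survive.
  These number at most \<open>(m choose 2) (m-2 choose r-2)\<^sup>2\<close>, which makes
  \<open>E R\<^sup>2 / (c\<^sup>2 E L\<^sup>2)\<close> at most \<open>r\<^sup>4 B\<^sup>2 / (m \<sigma>\<^sup>2)\<close> (\<open>remainder_ratio_le\<close>). By orthogonality the same
  quantity bounds the squared \<open>L\<^sup>2\<close>-distance between the standardized \<open>Z\<close> and the standardized
  \<open>L\<close>, hence, up to the factor \<open>\<bar>t\<bar>\<close> and a square root, the distance of their characteristic functions
  at \<open>t\<close>. The characteristic function of the standardized \<open>L\<close> is a product of \<open>m\<close> equal factors
  and tends to that of the normal law as soon as \<open>B\<^sup>2 / (m \<sigma>\<^sup>2)\<close> tends to \<open>0\<close>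
  (\<open>char_L_approx\<close>). So this one condition gives asymptotic normality (\<open>subset_kernel_clt\<close>).

  For the gcd one has \<open>B = n\<^sup>q\<close>, whose square is at most \<open>m\<close> to the power \<open>2 \<beta> < 1\<close>, and it
  remains to bound \<open>\<sigma>\<^sup>2\<close> from below independently of \<open>n\<close>. Doubling an odd number \<open>a\<close> raises
  the gcd by at least \<open>1\<close> whenever the other \<open>r - 1\<close> variables are all even, which has
  probability at least \<open>3\<close> to the power \<open>1 - r\<close> (\<open>gcd_projection_double\<close>); so \<open>g(a)\<close> and
  \<open>g(2 a)\<close> cannot both be close to the mean, and such disjoint pairs fill a fixed proportion of
  \<open>{1..n}\<close>.

  All moments are computed on the finite product distribution \<open>Pi_pmf\<close>, where everything is
  integrable; the given probability spaces enter only through the law of \<open>Z\<close>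
  (\<open>distr_function_of_indep_vars_eq\<close>).\<close>

section \<open>Resampling coordinates of a product distribution\<close>

lemma expectation_pair_pmf_finite:
  fixes f :: "'a \<times> 'b \<Rightarrow> real"
  assumes "finite (set_pmf p)" "finite (set_pmf q)"
  shows "measure_pmf.expectation (pair_pmf p q) f =
    measure_pmf.expectation p (\<lambda>x. measure_pmf.expectation q (\<lambda>y. f (x, y)))"
proof -
  have "measure_pmf.expectation (pair_pmf p q) f =
      (\<Sum>z\<in>set_pmf p \<times> set_pmf q. f z * pmf (pair_pmf p q) z)"
    using assms by (intro integral_measure_pmf_real) auto
  also have "\<dots> = (\<Sum>x\<in>set_pmf p. (\<Sum>y\<in>set_pmf q. f (x, y) * pmf q y) * pmf p x)"
    by (simp add: sum.cartesian_product' pmf_pair sum_distrib_right sum_distrib_left mult_ac)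
  also have "\<dots> = (\<Sum>x\<in>set_pmf p. measure_pmf.expectation q (\<lambda>y. f (x, y)) * pmf p x)"
    using assms by (intro sum.cong refl arg_cong2[where f="(*)"] integral_measure_pmf_real [symmetric]) auto
  also have "\<dots> = measure_pmf.expectation p (\<lambda>x. measure_pmf.expectation q (\<lambda>y. f (x, y)))"
    using assms by (intro integral_measure_pmf_real [symmetric]) auto
  finally show ?thesis .
qed

text \<open>Replacing the coordinates in \<open>K\<close> by those of an independent copy does not change a product
  distribution. This plays the role of conditioning on the coordinates outside \<open>K\<close>.\<close>

lemma Pi_pmf_resample:
  assumes "finite A"
  shows "Pi_pmf A d p =
    map_pmf (\<lambda>(x, y) k. if k \<in> K then y k else x k) (pair_pmf (Pi_pmf A d p) (Pi_pmf A d p))"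
    (is "?P = map_pmf ?z (pair_pmf ?P ?P)")
proof -
  let ?res = "\<lambda>S (f :: 'a \<Rightarrow> 'b) k. if k \<in> S then f k else d"
  have "?P = Pi_pmf ((A - K) \<union> (A \<inter> K)) d p"
    by (rule arg_cong [where f = "\<lambda>S. Pi_pmf S d p"]) blast
  also have "\<dots> = map_pmf (\<lambda>(f, g) x. if x \<in> A - K then f x else g x)
      (pair_pmf (map_pmf (?res (A - K)) ?P) (map_pmf (?res (A \<inter> K)) ?P))"
    using assms by (subst Pi_pmf_union)
      (auto simp: Pi_pmf_subset [of A "A - K"] Pi_pmf_subset [of A "A \<inter> K"])
  also have "\<dots> = map_pmf (\<lambda>(f, g). \<lambda>x. if x \<in> A - K then f x else ?res (A \<inter> K) g x) (pair_pmf ?P ?P)"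
    by (auto simp: map_pair [symmetric] pmf.map_comp intro!: map_pmf_cong)
  also have "\<dots> = map_pmf ?z (pair_pmf ?P ?P)"
  proof (intro map_pmf_cong refl)
    fix z assume "z \<in> set_pmf (pair_pmf ?P ?P)"
    then have "k \<notin> A \<Longrightarrow> fst z k = d" "k \<notin> A \<Longrightarrow> snd z k = d" for k
      using set_Pi_pmf_subset [OF assms, of d p] by auto
    then show "(case z of (f, g) \<Rightarrow> \<lambda>x. if x \<in> A - K then f x else ?res (A \<inter> K) g x) = ?z z"
      by (auto simp: fun_eq_iff split: prod.splits)
  qed
  finally show ?thesis .
qed

lemma finite_set_Pi_pmf:
  assumes "finite A" "\<And>i. i \<in> A \<Longrightarrow> finite (set_pmf (p i))"
  shows "finite (set_pmf (Pi_pmf A d p))"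
  using assms by (simp add: set_Pi_pmf finite_PiE_dflt)

lemma expectation_Pi_pmf_resample:
  fixes f :: "('i \<Rightarrow> 'b) \<Rightarrow> real"
  assumes "finite A" "\<And>i. i \<in> A \<Longrightarrow> finite (set_pmf (p i))"
  shows "measure_pmf.expectation (Pi_pmf A d p) f =
    measure_pmf.expectation (Pi_pmf A d p) (\<lambda>x. measure_pmf.expectation (Pi_pmf A d p)
      (\<lambda>y. f (\<lambda>k. if k \<in> K then y k else x k)))"
  using finite_set_Pi_pmf [of A p d] assms
  by (subst Pi_pmf_resample [OF assms(1), of d p K])
     (simp add: expectation_pair_pmf_finite)

lemma expectation_Pi_pmf_component:
  fixes f :: "'b \<Rightarrow> real"
  assumes "finite A" "i \<in> A"
  shows "measure_pmf.expectation (Pi_pmf A d p) (\<lambda>x. f (x i)) = measure_pmf.expectation (p i) f"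
proof -
  have "measure_pmf.expectation (Pi_pmf A d p) (\<lambda>x. f (x i)) =
      measure_pmf.expectation (map_pmf (\<lambda>x. x i) (Pi_pmf A d p)) f"
    by simp
  then show ?thesis
    using assms by (simp add: Pi_pmf_component)
qed

section \<open>Counting subsets that contain a given set\<close>

lemma card_supersets_of_card:
  assumes "finite A" "S \<subseteq> A" "card S \<le> r"
  shows "card {I. I \<subseteq> A \<and> card I = r \<and> S \<subseteq> I} = (card A - card S) choose (r - card S)"
proof -
  have fS: "finite S" using assms finite_subset by blast
  have "card {I. I \<subseteq> A \<and> card I = r \<and> S \<subseteq> I} = card {T. T \<subseteq> A - S \<and> card T = r - card S}"
  proof (rule bij_betw_same_card [of "\<lambda>I. I - S"], rule bij_betw_byWitness [where f' = "\<lambda>T. T \<union> S"])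
    show "(\<lambda>I. I - S) ` {I. I \<subseteq> A \<and> card I = r \<and> S \<subseteq> I} \<subseteq> {T. T \<subseteq> A - S \<and> card T = r - card S}"
      using fS by (auto simp: card_Diff_subset)
    show "(\<lambda>T. T \<union> S) ` {T. T \<subseteq> A - S \<and> card T = r - card S} \<subseteq> {I. I \<subseteq> A \<and> card I = r \<and> S \<subseteq> I}"
    proof clarsimp
      fix T assume T: "T \<subseteq> A - S" "card T = r - card S"
      then have "finite T" using assms finite_subset by blast
      then have "card (T \<union> S) = card T + card S"
        using T fS by (intro card_Un_disjoint) auto
      then show "T \<subseteq> A \<and> S \<subseteq> A \<and> card (T \<union> S) = r"
        using T assms by auto
    qed
  qed auto
  also have "\<dots> = card (A - S) choose (r - card S)"
    using assms by (intro n_subsets) auto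
  finally show ?thesis
    using assms fS by (simp add: card_Diff_subset)
qed

section \<open>Mean-square distance of random variables\<close>

lemma (in prob_space) expectation_abs_le_sqrt:
  fixes f :: "'a \<Rightarrow> real"
  assumes "f \<in> borel_measurable M" "integrable M (\<lambda>x. (f x)\<^sup>2)"
  shows "expectation (\<lambda>x. \<bar>f x\<bar>) \<le> sqrt (expectation (\<lambda>x. (f x)\<^sup>2))"
proof -
  have int: "integrable M f"
    by (rule square_integrable_imp_integrable) (use assms in auto)
  have "0 \<le> variance (\<lambda>x. \<bar>f x\<bar>)"
    by (rule integral_nonneg_AE) auto
  also have "\<dots> = expectation (\<lambda>x. (f x)\<^sup>2) - (expectation (\<lambda>x. \<bar>f x\<bar>))\<^sup>2"
    using int assms by (subst variance_eq) auto
  finally show ?thesis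
    by (intro real_le_rsqrt) simp
qed

text \<open>The function \<open>iexp\<close> is 1-Lipschitz, so mean-square closeness of random variables carries over to
  their characteristic functions.\<close>

lemma (in prob_space) cmod_char_diff_le:
  fixes U V :: "'a \<Rightarrow> real"
  assumes [measurable]: "U \<in> borel_measurable M" "V \<in> borel_measurable M"
    and int: "integrable M (\<lambda>x. (U x - V x)\<^sup>2)"
  shows "cmod (char (distr M borel U) t - char (distr M borel V) t)
    \<le> \<bar>t\<bar> * sqrt (expectation (\<lambda>x. (U x - V x)\<^sup>2))"
proof -
  have lip: "cmod (iexp a - iexp b) \<le> \<bar>a - b\<bar>" for a b
  proof -
    have "iexp a - iexp b = iexp b * (iexp (a - b) - 1)"
      by (simp add: algebra_simps flip: exp_add)
    then have "cmod (iexp a - iexp b) = cmod (iexp (a - b) - 1)"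
      by (simp add: norm_mult del: of_real_diff)
    also have "\<dots> \<le> \<bar>a - b\<bar>"
      using iexp_approx1 [of "a - b" 0] by simp
    finally show ?thesis .
  qed
  have intd: "integrable M (\<lambda>x. U x - V x)"
    by (rule square_integrable_imp_integrable) (use int in auto)
  have i: "integrable M (\<lambda>x. iexp (t * U x))" "integrable M (\<lambda>x. iexp (t * V x))"
    by (intro integrable_iexp; simp)+
  have "cmod (char (distr M borel U) t - char (distr M borel V) t)
      = cmod (CLINT x|M. iexp (t * U x) - iexp (t * V x))"
    unfolding char_def using i by (simp add: integral_distr)
  also have "\<dots> \<le> (LINT x|M. cmod (iexp (t * U x) - iexp (t * V x)))"
    by (rule integral_norm_bound)
  also have "\<dots> \<le> (LINT x|M. \<bar>t\<bar> * \<bar>U x - V x\<bar>)"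
  proof (rule integral_mono)
    show "integrable M (\<lambda>x. cmod (iexp (t * U x) - iexp (t * V x)))"
      using i by (intro integrable_norm Bochner_Integration.integrable_diff)
    show "integrable M (\<lambda>x. \<bar>t\<bar> * \<bar>U x - V x\<bar>)"
      using intd by auto
    show "cmod (iexp (t * U x) - iexp (t * V x)) \<le> \<bar>t\<bar> * \<bar>U x - V x\<bar>" for x
      using lip [of "t * U x" "t * V x"] by (simp add: abs_mult flip: right_diff_distrib)
  qed
  also have "\<dots> \<le> \<bar>t\<bar> * sqrt (expectation (\<lambda>x. (U x - V x)\<^sup>2))"
    using expectation_abs_le_sqrt [of "\<lambda>x. U x - V x"] int by (simp add: mult_left_mono)
  finally show ?thesis .
qed

text \<open>With \<open>l = E L\<^sup>2\<close> and \<open>e = E R\<^sup>2\<close>, orthogonality gives \<open>E (L + R)\<^sup>2 = l + e\<close> and correlation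
  \<open>sqrt l / sqrt (l + e)\<close> of \<open>L\<close> with \<open>L + R\<close>, so the squared distance is exactly
  \<open>2 - 2 sqrt l / sqrt (l + e)\<close>.\<close>

lemma (in prob_space) standardized_orthogonal_perturbation:
  fixes L R :: "'a \<Rightarrow> real"
  assumes int: "integrable M (\<lambda>x. (L x)\<^sup>2)" "integrable M (\<lambda>x. (R x)\<^sup>2)" "integrable M (\<lambda>x. L x * R x)"
    and orth: "expectation (\<lambda>x. L x * R x) = 0"
    and pos: "expectation (\<lambda>x. (L x)\<^sup>2) > 0"
  shows "expectation (\<lambda>x. ((L x + R x) / sqrt (expectation (\<lambda>x. (L x + R x)\<^sup>2))
      - L x / sqrt (expectation (\<lambda>x. (L x)\<^sup>2)))\<^sup>2)
    \<le> expectation (\<lambda>x. (R x)\<^sup>2) / expectation (\<lambda>x. (L x)\<^sup>2)"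
proof -
  define l where "l = expectation (\<lambda>x. (L x)\<^sup>2)"
  define e where "e = expectation (\<lambda>x. (R x)\<^sup>2)"
  have l: "l > 0" and e: "e \<ge> 0" using pos by (auto simp: l_def e_def)
  have sq: "expectation (\<lambda>x. (L x + R x)\<^sup>2) = l + e"
    using int orth by (simp add: power2_sum l_def e_def mult.assoc)
  define a b where "a = 1 / sqrt (l + e)" and "b = 1 / sqrt l"
  have "((L x + R x) / sqrt (l + e) - L x / sqrt l)\<^sup>2
      = (a - b)\<^sup>2 * (L x)\<^sup>2 + a\<^sup>2 * (R x)\<^sup>2 + 2 * (a - b) * a * (L x * R x)" for x
    unfolding a_def b_def by algebra
  then have "expectation (\<lambda>x. ((L x + R x) / sqrt (l + e) - L x / sqrt l)\<^sup>2) = (a - b)\<^sup>2 * l + a\<^sup>2 * e"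
    using int orth by (simp add: l_def e_def)
  also have "\<dots> = a\<^sup>2 * (l + e) + b\<^sup>2 * l - 2 * a * b * l"
    by algebra
  also have "\<dots> = 2 - 2 * (sqrt l / sqrt (l + e))"
  proof -
    have "a\<^sup>2 * (l + e) = 1" "b\<^sup>2 * l = 1" using l e by (auto simp: a_def b_def power_divide)
    moreover have "b * l = sqrt l" using l by (simp add: b_def real_div_sqrt)
    then have "2 * a * b * l = 2 * (sqrt l / sqrt (l + e))" by (simp add: a_def mult.assoc)
    ultimately show ?thesis by simp
  qed
  also have "\<dots> \<le> e / l"
  proof -
    \<comment> \<open>the geometric mean of \<open>l\<close> and \<open>l + e\<close> is at most \<open>l + e / 2\<close>\<close>
    have "sqrt l * sqrt (l + e) \<le> l + e / 2"
      using arith_geo_mean_sqrt [of l "l + e"] l e unfolding real_sqrt_mult by simp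
    then have "(sqrt l * sqrt (l + e)) / l \<le> (l + e / 2) / l"
      using l by (intro divide_right_mono) auto
    moreover have "(sqrt l * sqrt (l + e)) / l = sqrt (l + e) / sqrt l"
      using l by (subst real_div_sqrt [of l, symmetric]) (auto simp: field_simps)
    ultimately have "sqrt (l + e) / sqrt l \<le> 1 + e / (2 * l)"
      using l by (simp add: add_divide_distrib)
    moreover have "2 - sqrt (l + e) / sqrt l \<le> sqrt l / sqrt (l + e)"
    proof -
      have "2 - 1 / u \<le> u" if "u > 0" for u :: real
      proof -
        have "0 \<le> (u - 1)\<^sup>2 / u" using that by simp
        also have "\<dots> = u - 2 + 1 / u" using that by (simp add: field_simps power2_eq_square)
        finally show ?thesis by simp
      qed
      from this [of "sqrt l / sqrt (l + e)"] show ?thesis using l e by simp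
    qed
    ultimately show ?thesis by simp
  qed
  finally show ?thesis
    unfolding sq l_def [symmetric] e_def [symmetric] .
qed

section \<open>Hoeffding decomposition of a U-statistic\<close>

text \<open>The kernel is indexed by the \<open>r\<close>-subsets of the index set rather than being a symmetric function
  of \<open>r\<close> arguments: \<open>h I x\<close> may depend only on the values of \<open>x\<close> on \<open>I\<close>. Symmetry enters as
  \<open>h_projection\<close>: the projection \<open>g\<close> on one coordinate is the same for all \<open>I\<close> and all \<open>i \<in> I\<close>.
  Finite support makes every function of the variables integrable.\<close>

locale subset_kernel =
  fixes p :: "'b pmf" and d :: 'b and A :: "'i set" and r :: nat
    and h :: "'i set \<Rightarrow> ('i \<Rightarrow> 'b) \<Rightarrow> real" and g :: "'b \<Rightarrow> real" and B :: real
  assumes finite_A: "finite A" and r_ge_2: "2 \<le> r" and r_le: "r \<le> card A"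
    and finite_support: "finite (set_pmf p)"
    and h_local: "\<And>I x y. \<lbrakk>I \<subseteq> A; card I = r; \<And>i. i \<in> I \<Longrightarrow> x i = y i\<rbrakk> \<Longrightarrow> h I x = h I y"
    and h_bounds: "\<And>I x. \<lbrakk>I \<subseteq> A; card I = r; \<And>i. i \<in> A \<Longrightarrow> x i \<in> set_pmf p\<rbrakk> \<Longrightarrow> h I x \<in> {0..B}"
    and h_projection: "\<And>I i a. \<lbrakk>I \<subseteq> A; card I = r; i \<in> I; a \<in> set_pmf p\<rbrakk> \<Longrightarrow>
      measure_pmf.expectation (Pi_pmf A d (\<lambda>_. p)) (\<lambda>x. h I (x(i := a))) = g a"
begin

abbreviation P :: "('i \<Rightarrow> 'b) pmf" where "P \<equiv> Pi_pmf A d (\<lambda>_. p)"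
abbreviation E :: "(('i \<Rightarrow> 'b) \<Rightarrow> real) \<Rightarrow> real" where "E \<equiv> measure_pmf.expectation P"
abbreviation Subs :: "'i set set" where "Subs \<equiv> {I. I \<subseteq> A \<and> card I = r}"

definition mean :: real where "mean = measure_pmf.expectation p g"
definition var :: real where "var = measure_pmf.expectation p (\<lambda>a. (g a - mean)\<^sup>2)"

definition U :: "('i \<Rightarrow> 'b) \<Rightarrow> real" where "U x = (\<Sum>I\<in>Subs. h I x)"
text \<open>The Hoeffding decomposition is \<open>U = E U + (n-1 choose r-1) L + R\<close> with \<open>n = card A\<close>; it is proved
  in \<open>U_decomposition\<close>.\<close>
definition L :: "('i \<Rightarrow> 'b) \<Rightarrow> real" where "L x = (\<Sum>i\<in>A. g (x i) - mean)"
definition W :: "'i set \<Rightarrow> ('i \<Rightarrow> 'b) \<Rightarrow> real" where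
  "W I x = h I x - mean - (\<Sum>i\<in>I. g (x i) - mean)"
definition R :: "('i \<Rightarrow> 'b) \<Rightarrow> real" where "R x = (\<Sum>I\<in>Subs. W I x)"

lemma finite_Subs [simp]: "finite Subs"
  using finite_A by simp

lemma finite_P: "finite (set_pmf P)"
  using finite_A finite_support by (intro finite_set_Pi_pmf)

lemma integrable_P [simp]: "integrable (measure_pmf P) (f :: _ \<Rightarrow> real)"
  by (rule integrable_measure_pmf_finite [OF finite_P])

lemma integrable_p [simp]: "integrable (measure_pmf p) (f :: _ \<Rightarrow> real)"
  by (rule integrable_measure_pmf_finite [OF finite_support])

lemma in_support_P: "x \<in> set_pmf P \<Longrightarrow> i \<in> A \<Longrightarrow> x i \<in> set_pmf p"
  using finite_A by (auto simp: set_Pi_pmf PiE_dflt_def)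

lemma E_cong: "(\<And>x. x \<in> set_pmf P \<Longrightarrow> f x = f' x) \<Longrightarrow> E f = E f'"
  by (intro integral_cong_AE) (auto simp: AE_measure_pmf_iff)

lemma E_mono: "(\<And>x. x \<in> set_pmf P \<Longrightarrow> f x \<le> f' x) \<Longrightarrow> E f \<le> E f'"
  by (intro integral_mono_AE) (auto simp: AE_measure_pmf_iff)

lemma E_component: "i \<in> A \<Longrightarrow> E (\<lambda>x. f (x i)) = measure_pmf.expectation p f"
  using finite_A by (rule expectation_Pi_pmf_component)

lemma E_resample:
  "E f = E (\<lambda>x. E (\<lambda>y. f (\<lambda>k. if k \<in> K then y k else x k)))"
  by (rule expectation_Pi_pmf_resample [OF finite_A finite_support])

lemma expectation_centred: "measure_pmf.expectation p (\<lambda>a. g a - mean) = 0"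
  by (simp add: mean_def)

lemma W_conditional_mean:
  assumes I: "I \<in> Subs" "i \<in> I" and a: "a \<in> set_pmf p"
  shows "E (\<lambda>x. W I (x(i := a))) = 0"
proof -
  have "I \<subseteq> A" "finite I" using I finite_A finite_subset by auto
  have "E (\<lambda>x. \<Sum>j\<in>I. g ((x(i := a)) j) - mean) = (\<Sum>j\<in>I. E (\<lambda>x. g ((x(i := a)) j) - mean))"
    by (rule Bochner_Integration.integral_sum) simp
  also have "\<dots> = (\<Sum>j\<in>I. if j = i then g a - mean else 0)"
  proof (rule sum.cong [OF refl])
    fix j assume "j \<in> I"
    then show "E (\<lambda>x. g ((x(i := a)) j) - mean) = (if j = i then g a - mean else 0)"
      using E_component [of j "\<lambda>b. g b - mean"] expectation_centred \<open>I \<subseteq> A\<close> by auto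
  qed
  also have "\<dots> = g a - mean" using I \<open>finite I\<close> by simp
  finally show ?thesis
    using h_projection [of I i a] I a by (simp add: W_def)
qed

lemma W_local:
  assumes "I \<in> Subs" "\<And>i. i \<in> I \<Longrightarrow> x i = y i"
  shows "W I x = W I y"
proof -
  have "h I x = h I y" using assms by (intro h_local) auto
  moreover have "(\<Sum>i\<in>I. g (x i) - mean) = (\<Sum>i\<in>I. g (y i) - mean)"
    using assms(2) by simp
  ultimately show ?thesis by (simp add: W_def)
qed

text \<open>Since \<open>F\<close> ignores the coordinates in \<open>J - {i}\<close>, resampling these averages \<open>W J\<close> alone, with
  \<open>x i\<close> held fixed, and this average is \<open>0\<close>.\<close>

lemma W_orthogonal:
  assumes J: "J \<in> Subs" "i \<in> J"
    and F: "\<And>x y. (\<And>k. k \<notin> J - {i} \<Longrightarrow> x k = y k) \<Longrightarrow> F x = F y"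
  shows "E (\<lambda>x. F x * W J x) = 0"
proof -
  let ?z = "\<lambda>x y k. if k \<in> J - {i} then y k else x k"
  have "E (\<lambda>x. F x * W J x) = E (\<lambda>x. E (\<lambda>y. F (?z x y) * W J (?z x y)))"
    by (rule E_resample)
  also have "\<dots> = E (\<lambda>x. 0)"
  proof (rule E_cong)
    fix x assume x: "x \<in> set_pmf P"
    have "F (?z x y) = F x" for y by (rule F) auto
    moreover have "W J (?z x y) = W J (y(i := x i))" for y
      using J by (intro W_local) auto
    ultimately have "E (\<lambda>y. F (?z x y) * W J (?z x y)) = F x * E (\<lambda>y. W J (y(i := x i)))"
      by simp
    also have "\<dots> = 0"
      using J x W_conditional_mean [of J i "x i"] in_support_P [of x i] by auto
    finally show "E (\<lambda>y. F (?z x y) * W J (?z x y)) = 0" .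
  qed
  finally show ?thesis by simp
qed

text \<open>Each index \<open>i\<close> lies in \<open>(n-1 choose r-1)\<close> of the \<open>r\<close>-subsets, where \<open>n = card A\<close>; this is the
  coefficient of \<open>L\<close>.\<close>

lemma U_decomposition:
  "U x = real (card A choose r) * mean + (real ((card A - 1) choose (r - 1)) * L x + R x)"
proof -
  have "(\<Sum>I\<in>Subs. \<Sum>i\<in>I. g (x i) - mean) = (\<Sum>I\<in>Subs. \<Sum>i\<in>A. if i \<in> I then g (x i) - mean else 0)"
  proof (rule sum.cong [OF refl])
    fix I assume "I \<in> Subs"
    then have "A \<inter> I = I" by auto
    then show "(\<Sum>i\<in>I. g (x i) - mean) = (\<Sum>i\<in>A. if i \<in> I then g (x i) - mean else 0)"
      using sum.inter_restrict [OF finite_A, of "\<lambda>i. g (x i) - mean" I] by simp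
  qed
  also have "\<dots> = (\<Sum>i\<in>A. \<Sum>I\<in>Subs. if i \<in> I then g (x i) - mean else 0)"
    by (rule sum.swap)
  also have "\<dots> = (\<Sum>i\<in>A. real ((card A - 1) choose (r - 1)) * (g (x i) - mean))"
  proof (rule sum.cong [OF refl])
    fix i assume "i \<in> A"
    have "(\<Sum>I\<in>Subs. if i \<in> I then g (x i) - mean else 0)
        = real (card {I. I \<subseteq> A \<and> card I = r \<and> {i} \<subseteq> I}) * (g (x i) - mean)"
      using finite_A by (auto simp: sum.If_cases Int_def conj_assoc)
    also have "card {I. I \<subseteq> A \<and> card I = r \<and> {i} \<subseteq> I} = (card A - 1) choose (r - 1)"
      using card_supersets_of_card [of A "{i}" r] finite_A \<open>i \<in> A\<close> r_ge_2 by simp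
    finally show "(\<Sum>I\<in>Subs. if i \<in> I then g (x i) - mean else 0)
        = real ((card A - 1) choose (r - 1)) * (g (x i) - mean)" .
  qed
  finally have *: "(\<Sum>I\<in>Subs. \<Sum>i\<in>I. g (x i) - mean) = real ((card A - 1) choose (r - 1)) * L x"
    by (simp add: L_def sum_distrib_left)
  have "R x = U x - real (card Subs) * mean - (\<Sum>I\<in>Subs. \<Sum>i\<in>I. g (x i) - mean)"
    unfolding R_def W_def U_def sum_subtractf by simp
  then show ?thesis
    using n_subsets [OF finite_A, of r] * by simp
qed

lemma E_L: "E L = 0"
proof -
  have "E L = (\<Sum>i\<in>A. E (\<lambda>x. g (x i) - mean))"
    unfolding L_def by (rule Bochner_Integration.integral_sum) simp
  also have "\<dots> = 0"
    using E_component [of _ "\<lambda>b. g b - mean"] expectation_centred by (intro sum.neutral) auto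
  finally show ?thesis .
qed

lemma E_L_square: "E (\<lambda>x. (L x)\<^sup>2) = real (card A) * var"
proof -
  have "E (\<lambda>x. (L x)\<^sup>2) = E (\<lambda>x. \<Sum>i\<in>A. \<Sum>j\<in>A. (g (x i) - mean) * (g (x j) - mean))"
    by (simp add: L_def power2_eq_square sum_product)
  also have "\<dots> = (\<Sum>i\<in>A. \<Sum>j\<in>A. E (\<lambda>x. (g (x i) - mean) * (g (x j) - mean)))"
    by (simp add: Bochner_Integration.integral_sum)
  also have "\<dots> = (\<Sum>i\<in>A. \<Sum>j\<in>A. if j = i then var else 0)"
  proof (intro sum.cong refl)
    fix i j assume i: "i \<in> A" and j: "j \<in> A"
    show "E (\<lambda>x. (g (x i) - mean) * (g (x j) - mean)) = (if j = i then var else 0)"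
    proof (cases "j = i")
      case True
      then show ?thesis
        using E_component [OF i, of "\<lambda>b. (g b - mean)\<^sup>2"] by (simp add: var_def power2_eq_square)
    next
      case False
      have "E (\<lambda>x. (g (x i) - mean) * (g (x j) - mean))
          = E (\<lambda>x. E (\<lambda>y. (g (x i) - mean) * (g (y j) - mean)))"
        using False by (subst E_resample [where K = "{j}"]) simp
      also have "\<dots> = 0"
        using E_component [OF j, of "\<lambda>b. g b - mean"] expectation_centred by simp
      finally show ?thesis using False by simp
    qed
  qed
  also have "\<dots> = real (card A) * var"
    using finite_A by simp
  finally show ?thesis .
qed

lemma Subs_nonempty: "I \<in> Subs \<Longrightarrow> \<exists>i. i \<in> I"
  using r_ge_2 by (cases "I = {}") auto

lemma E_R: "E R = 0"
proof -
  have "E (W I) = 0" if "I \<in> Subs" for I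
    using W_orthogonal [OF that, of _ "\<lambda>_. 1"] Subs_nonempty [OF that] by auto
  then show ?thesis
    by (simp add: R_def [abs_def] Bochner_Integration.integral_sum)
qed

lemma E_L_R: "E (\<lambda>x. L x * R x) = 0"
proof -
  have "E (\<lambda>x. (g (x i) - mean) * W J x) = 0" if J: "J \<in> Subs" for i J
  proof -
    \<comment> \<open>\<open>j = i\<close> if \<open>i \<in> J\<close>, and any element of \<open>J\<close> otherwise\<close>
    obtain j where "j \<in> J" "i \<notin> J - {j}"
      using Subs_nonempty [OF J] by (cases "i \<in> J") auto
    then show ?thesis
      by (intro W_orthogonal [OF J]) auto
  qed
  then have "(\<Sum>i\<in>A. \<Sum>J\<in>Subs. E (\<lambda>x. (g (x i) - mean) * W J x)) = 0"
    by (intro sum.neutral ballI) auto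
  then show ?thesis
    by (simp add: L_def R_def sum_product Bochner_Integration.integral_sum)
qed

lemma E_U: "E U = real (card A choose r) * mean"
  using E_L E_R by (subst U_decomposition [abs_def]) simp

lemma g_bounds:
  assumes "a \<in> set_pmf p"
  shows "g a \<in> {0..B}"
proof -
  obtain I where I: "I \<subseteq> A" "card I = r"
    using r_le by (meson obtain_subset_with_card_n)
  then obtain i where i: "i \<in> I" using Subs_nonempty [of I] by auto
  have *: "h I (x(i := a)) \<in> {0..B}" if "x \<in> set_pmf P" for x
    using in_support_P [OF that] assms I by (intro h_bounds) auto
  have "E (\<lambda>x. 0) \<le> E (\<lambda>x. h I (x(i := a)))" "E (\<lambda>x. h I (x(i := a))) \<le> E (\<lambda>x. B)"
    using * by (intro E_mono; simp)+
  then show ?thesis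
    using h_projection [OF I i assms] by simp
qed

lemma mean_bounds: "mean \<in> {0..B}"
proof -
  have "measure_pmf.expectation p (\<lambda>_. 0) \<le> mean" "mean \<le> measure_pmf.expectation p (\<lambda>_. B)"
    unfolding mean_def using g_bounds by (intro integral_mono_AE; auto simp: AE_measure_pmf_iff)+
  then show ?thesis by simp
qed

lemma abs_centred_le: "a \<in> set_pmf p \<Longrightarrow> \<bar>g a - mean\<bar> \<le> B"
  using g_bounds [of a] mean_bounds by auto

lemma abs_W_le:
  assumes "I \<in> Subs" "x \<in> set_pmf P"
  shows "\<bar>W I x\<bar> \<le> real (r + 1) * B"
proof -
  have "\<bar>W I x\<bar> \<le> \<bar>h I x - mean\<bar> + \<bar>\<Sum>i\<in>I. g (x i) - mean\<bar>"
    unfolding W_def by (rule abs_triangle_ineq4)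
  also have "\<bar>h I x - mean\<bar> \<le> B"
    using h_bounds [of I x] in_support_P [OF assms(2)] assms(1) mean_bounds by auto
  also have "\<bar>\<Sum>i\<in>I. g (x i) - mean\<bar> \<le> (\<Sum>i\<in>I. \<bar>g (x i) - mean\<bar>)"
    by (rule sum_abs)
  also have "\<dots> \<le> (\<Sum>i\<in>I. B)"
    using assms in_support_P by (intro sum_mono abs_centred_le) auto
  also have "B + (\<Sum>i\<in>I. B) = real (r + 1) * B"
    using assms by (simp add: algebra_simps)
  finally show ?thesis by simp
qed

text \<open>Two subsets with at most one common element contribute \<open>0\<close>. All others are counted, with
  multiplicity, by the two-element sets \<open>S\<close> that both contain, and each \<open>S\<close> lies in
  \<open>(n-2 choose r-2)\<close> of the \<open>r\<close>-subsets, where \<open>n = card A\<close>.\<close>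

lemma E_R_square_le:
  "E (\<lambda>x. (R x)\<^sup>2)
    \<le> (real (r + 1) * B)\<^sup>2 * (real (card A choose 2) * (real ((card A - 2) choose (r - 2)))\<^sup>2)"
proof -
  let ?K = "(real (r + 1) * B)\<^sup>2"
  let ?Pairs = "{S. S \<subseteq> A \<and> card S = 2}"
  have fin: "finite ?Pairs" using finite_A by simp
  have summand: "E (\<lambda>x. W I x * W J x) \<le> ?K * (\<Sum>S\<in>?Pairs. of_bool (S \<subseteq> I) * of_bool (S \<subseteq> J))"
    if I: "I \<in> Subs" and J: "J \<in> Subs" for I J
  proof (cases "\<exists>S\<in>?Pairs. S \<subseteq> I \<and> S \<subseteq> J")
    case True
    then obtain S where S: "S \<in> ?Pairs" "S \<subseteq> I" "S \<subseteq> J" by blast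
    have "E (\<lambda>x. W I x * W J x) \<le> E (\<lambda>x. ?K)"
    proof (rule E_mono)
      fix x assume x: "x \<in> set_pmf P"
      have "W I x * W J x \<le> \<bar>W I x\<bar> * \<bar>W J x\<bar>"
        by (metis abs_ge_self abs_mult)
      also have "\<dots> \<le> ?K"
        unfolding power2_eq_square
        using abs_W_le [OF I x] abs_W_le [OF J x] by (intro mult_mono) auto
      finally show "W I x * W J x \<le> ?K" .
    qed
    also have "\<dots> = ?K * 1" by simp
    also have "1 \<le> (\<Sum>S\<in>?Pairs. of_bool (S \<subseteq> I) * of_bool (S \<subseteq> J) :: real)"
      using member_le_sum [OF S(1), of "\<lambda>S. of_bool (S \<subseteq> I) * of_bool (S \<subseteq> J) :: real"] fin S by simp
    finally show ?thesis by (simp add: mult_left_mono)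
  next
    case False
    \<comment> \<open>the common element of \<open>I\<close> and \<open>J\<close>, or any element of \<open>J\<close> if there is none\<close>
    obtain i where i: "i \<in> J" "I \<inter> (J - {i}) = {}"
    proof (cases "I \<inter> J = {}")
      case True
      then show ?thesis using Subs_nonempty [OF J] that by blast
    next
      case False
      then obtain i where i: "i \<in> I" "i \<in> J" by blast
      have "j = i" if "j \<in> I" "j \<in> J" for j
      proof (rule ccontr)
        assume "j \<noteq> i"
        then have "{i, j} \<in> ?Pairs" "{i, j} \<subseteq> I" "{i, j} \<subseteq> J" using i that I by auto
        then show False using \<open>\<not> (\<exists>S\<in>?Pairs. S \<subseteq> I \<and> S \<subseteq> J)\<close> by blast
      qed
      then show ?thesis using i that by blast
    qed
    have "E (\<lambda>x. W I x * W J x) = 0"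
      using i by (intro W_orthogonal [OF J i(1)] W_local [OF I]) auto
    then show ?thesis by (simp add: sum_nonneg)
  qed
  have "E (\<lambda>x. (R x)\<^sup>2) = (\<Sum>I\<in>Subs. \<Sum>J\<in>Subs. E (\<lambda>x. W I x * W J x))"
    by (simp add: R_def power2_eq_square sum_product Bochner_Integration.integral_sum)
  also have "\<dots> \<le> (\<Sum>I\<in>Subs. \<Sum>J\<in>Subs. ?K * (\<Sum>S\<in>?Pairs. of_bool (S \<subseteq> I) * of_bool (S \<subseteq> J)))"
    by (intro sum_mono summand)
  also have "\<dots> = ?K * (\<Sum>I\<in>Subs. \<Sum>J\<in>Subs. \<Sum>S\<in>?Pairs. of_bool (S \<subseteq> I) * of_bool (S \<subseteq> J))"
    by (simp add: sum_distrib_left)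
  also have "(\<Sum>I\<in>Subs. \<Sum>J\<in>Subs. \<Sum>S\<in>?Pairs. of_bool (S \<subseteq> I) * of_bool (S \<subseteq> J))
      = (\<Sum>I\<in>Subs. \<Sum>S\<in>?Pairs. \<Sum>J\<in>Subs. of_bool (S \<subseteq> I) * of_bool (S \<subseteq> J) :: real)"
    by (intro sum.cong refl sum.swap)
  also have "\<dots> = (\<Sum>S\<in>?Pairs. \<Sum>I\<in>Subs. \<Sum>J\<in>Subs. of_bool (S \<subseteq> I) * of_bool (S \<subseteq> J) :: real)"
    by (rule sum.swap)
  also have "\<dots> = (\<Sum>S\<in>?Pairs. (\<Sum>I\<in>Subs. of_bool (S \<subseteq> I) :: real)\<^sup>2)"
    by (simp only: power2_eq_square sum_product)
  also have "\<dots> = (\<Sum>S\<in>?Pairs. (real ((card A - 2) choose (r - 2)))\<^sup>2)"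
  proof (rule sum.cong [OF refl])
    fix S assume "S \<in> ?Pairs"
    then have "card {I. I \<subseteq> A \<and> card I = r \<and> S \<subseteq> I} = (card A - 2) choose (r - 2)"
      using card_supersets_of_card [of A S r] finite_A r_ge_2 by auto
    moreover have "(\<Sum>I\<in>Subs. of_bool (S \<subseteq> I) :: real) = real (card {I. I \<subseteq> A \<and> card I = r \<and> S \<subseteq> I})"
      using finite_A by (simp add: of_bool_def sum.If_cases Int_def conj_assoc)
    ultimately show "(\<Sum>I\<in>Subs. of_bool (S \<subseteq> I) :: real)\<^sup>2 = (real ((card A - 2) choose (r - 2)))\<^sup>2"
      by simp
  qed
  also have "\<dots> = real (card A choose 2) * (real ((card A - 2) choose (r - 2)))\<^sup>2"
    using n_subsets [OF finite_A, of 2] by simp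
  finally show ?thesis .
qed

lemma C_pos: "real ((card A - 1) choose (r - 1)) > 0"
  using r_le r_ge_2 by simp

lemma remainder_ratio_le:
  assumes "var > 0"
  shows "E (\<lambda>x. (R x)\<^sup>2) / E (\<lambda>x. (real ((card A - 1) choose (r - 1)) * L x)\<^sup>2)
    \<le> real r ^ 4 * (B\<^sup>2 / (real (card A) * var))"
proof -
  define m where "m = card A"
  define c where "c = real ((m - 1) choose (r - 1))"
  define e where "e = real ((m - 2) choose (r - 2))"
  have m: "2 \<le> m" using r_ge_2 r_le by (simp add: m_def)
  have c: "c > 0" using C_pos by (simp add: c_def m_def)
  \<comment> \<open>absorption identity for binomial coefficients\<close>
  have ce: "real (r - 1) * c = real (m - 1) * e"
  proof -
    have "Suc (r - 2) * (Suc (m - 2) choose Suc (r - 2)) = Suc (m - 2) * ((m - 2) choose (r - 2))"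
      by (rule Suc_times_binomial)
    moreover have "Suc (r - 2) = r - 1" "Suc (m - 2) = m - 1" using m r_ge_2 by auto
    ultimately show ?thesis unfolding c_def e_def by (metis of_nat_mult)
  qed
  have ch2: "real (m choose 2) = real m * real (m - 1) / 2"
  proof -
    have "even (m * (m - 1))" by (cases m) auto
    then show ?thesis by (simp add: choose_two real_of_nat_div)
  qed
  have "E (\<lambda>x. (c * L x)\<^sup>2) = c\<^sup>2 * (real m * var)"
    using E_L_square by (simp add: power_mult_distrib m_def)
  moreover have "E (\<lambda>x. (R x)\<^sup>2) \<le> (real (r + 1) * B)\<^sup>2 * (real (m choose 2) * e\<^sup>2)"
    using E_R_square_le by (simp add: m_def e_def)
  ultimately have "E (\<lambda>x. (R x)\<^sup>2) / E (\<lambda>x. (c * L x)\<^sup>2)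
      \<le> (real (r + 1) * B)\<^sup>2 * (real (m choose 2) * e\<^sup>2) / (c\<^sup>2 * (real m * var))"
    using c m assms by (simp add: divide_right_mono)
  also have "\<dots> = (real (r + 1) * real (r - 1) * B)\<^sup>2 / (2 * real (m - 1) * var)"
  proof -
    have e: "e = real (r - 1) * c / real (m - 1)" using ce m by (simp add: field_simps)
    have "(x * B)\<^sup>2 * (y * k / 2 * (z * c / k)\<^sup>2) / (c\<^sup>2 * (y * var)) = (x * z * B)\<^sup>2 / (2 * k * var)"
      if "k > 0" "y > 0" for x y z k :: real
      using that c assms by (simp add: field_simps power2_eq_square)
    from this [of "real (m - 1)" "real m"] have "(real (r + 1) * B)\<^sup>2 *
        (real m * real (m - 1) / 2 * (real (r - 1) * c / real (m - 1))\<^sup>2) / (c\<^sup>2 * (real m * var))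
        = (real (r + 1) * real (r - 1) * B)\<^sup>2 / (2 * real (m - 1) * var)"
      using m by (simp del: of_nat_diff)
    then show ?thesis by (simp only: ch2 e)
  qed
  also have "\<dots> \<le> (real r ^ 2 * B)\<^sup>2 / (real m * var)"
  proof (rule frac_le)
    have "real (r + 1) * real (r - 1) \<le> real r ^ 2"
      using r_ge_2 by (simp add: of_nat_diff power2_eq_square algebra_simps)
    moreover have "0 \<le> B" using mean_bounds by auto
    ultimately show "(real (r + 1) * real (r - 1) * B)\<^sup>2 \<le> (real r ^ 2 * B)\<^sup>2"
      by (intro power_mono mult_right_mono) auto
    show "real m * var \<le> 2 * real (m - 1) * var"
      using m assms by (intro mult_right_mono) auto
    show "0 < real m * var" using m assms by simp
  qed auto
  also have "\<dots> = real r ^ 4 * (B\<^sup>2 / (real m * var))"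
    by (simp add: power_mult_distrib flip: power_mult)
  finally show ?thesis by (simp add: c_def m_def)
qed

lemma standardized_U_close_to_L:
  assumes "var > 0"
  shows "E (\<lambda>x. (standardized P U x - L x / sqrt (real (card A) * var))\<^sup>2)
    \<le> real r ^ 4 * (B\<^sup>2 / (real (card A) * var))"
proof -
  let ?c = "real ((card A - 1) choose (r - 1))"
  let ?D = "\<lambda>x. ?c * L x + R x"
  have c: "?c > 0" by (rule C_pos)
  have card: "card A > 0" using r_ge_2 r_le by auto
  have centred: "U x - E U = ?D x" for x
    by (subst U_decomposition) (simp add: E_U)
  have L2: "E (\<lambda>x. (?c * L x)\<^sup>2) = ?c\<^sup>2 * (real (card A) * var)"
    using E_L_square by (simp add: power_mult_distrib)
  have L: "?c * L x / sqrt (E (\<lambda>x. (?c * L x)\<^sup>2)) = L x / sqrt (real (card A) * var)" for x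
    unfolding L2 using c by (simp add: real_sqrt_mult)
  have "E (\<lambda>x. (?D x / sqrt (E (\<lambda>x. (?D x)\<^sup>2)) - ?c * L x / sqrt (E (\<lambda>x. (?c * L x)\<^sup>2)))\<^sup>2)
      \<le> E (\<lambda>x. (R x)\<^sup>2) / E (\<lambda>x. (?c * L x)\<^sup>2)"
  proof (rule measure_pmf.standardized_orthogonal_perturbation)
    show "E (\<lambda>x. ?c * L x * R x) = 0"
      using E_L_R by (simp add: mult.assoc)
    show "0 < E (\<lambda>x. (?c * L x)\<^sup>2)"
      unfolding L2 using c card assms by simp
  qed simp_all
  also have "\<dots> \<le> real r ^ 4 * (B\<^sup>2 / (real (card A) * var))"
    by (rule remainder_ratio_le [OF assms])
  finally show ?thesis
    unfolding L standardized_def centred .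
qed

text \<open>The standardized \<open>L\<close> is a sum of \<open>m = card A\<close> independent identically distributed variables
  \<open>Y\<close> with mean \<open>0\<close>, second moment \<open>1 / m\<close> and absolute value at most \<open>b = B / sqrt (m var)\<close>, so
  its characteristic function is an \<open>m\<close>-th power. As \<open>E \<bar>Y\<bar>\<^sup>3 \<le> b / m\<close>, each factor differs from
  \<open>1 - t\<^sup>2 / (2 m)\<close> by at most \<open>\<bar>t\<bar>\<^sup>3 b / (6 m)\<close>. The condition on \<open>t\<close> keeps
  \<open>1 - t\<^sup>2 / (2 m)\<close> in the unit disc, where the characteristic function of \<open>Y\<close> lies too, so that these
  errors add up to at most \<open>m\<close> times one of them.\<close>

lemma char_L_approx:
  assumes "var > 0" and t: "t\<^sup>2 \<le> 4 * real (card A)"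
  shows "cmod (char (distr P borel (\<lambda>x. L x / sqrt (real (card A) * var))) t
      - complex_of_real ((1 + (- (t\<^sup>2) / 2) / real (card A)) ^ card A))
    \<le> \<bar>t\<bar> ^ 3 / 6 * sqrt (B\<^sup>2 / (real (card A) * var))"
proof -
  define m where "m = card A"
  have m: "m > 0" using r_ge_2 r_le by (simp add: m_def)
  define s where "s = sqrt (real m * var)"
  have s: "s > 0" "s\<^sup>2 = real m * var" using m assms by (auto simp: s_def)
  have B: "B \<ge> 0" using mean_bounds by auto
  define Y where "Y a = (g a - mean) / s" for a
  define \<phi> where "\<phi> = char (distr p borel Y) t"
  have "prob_space.indep_vars P (\<lambda>_. borel) (\<lambda>i x. Y (x i)) A"
    by (rule prob_space.indep_vars_compose2 [OF _ indep_vars_Pi_pmf [OF finite_A]])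
       (auto intro: measure_pmf.prob_space_axioms)
  then have "char (distr P borel (\<lambda>x. \<Sum>i\<in>A. Y (x i))) t = (\<Prod>i\<in>A. char (distr P borel (\<lambda>x. Y (x i))) t)"
    by (rule prob_space.char_distr_sum [OF measure_pmf.prob_space_axioms])
  also have "\<dots> = (\<Prod>i\<in>A. \<phi>)"
  proof (rule prod.cong [OF refl])
    fix i assume "i \<in> A"
    then have "distr p borel Y = distr (map_pmf (\<lambda>x. x i) P) borel Y"
      using finite_A by (simp add: Pi_pmf_component)
    also have "\<dots> = distr P borel (\<lambda>x. Y (x i))"
      by (simp add: map_pmf_rep_eq distr_distr o_def)
    finally show "char (distr P borel (\<lambda>x. Y (x i))) t = \<phi>"
      by (simp add: \<phi>_def)
  qed
  also have "\<dots> = \<phi> ^ m" by (simp add: m_def)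
  also have "(\<lambda>x. \<Sum>i\<in>A. Y (x i)) = (\<lambda>x. L x / s)"
    by (simp add: Y_def L_def sum_divide_distrib)
  finally have prod: "char (distr P borel (\<lambda>x. L x / s)) t = \<phi> ^ m" .

  have Y0: "measure_pmf.expectation p Y = 0"
    using expectation_centred by (simp add: Y_def [abs_def])
  have Y2: "measure_pmf.expectation p (\<lambda>a. (Y a)\<^sup>2) = 1 / real m"
    using m assms s by (simp add: Y_def power_divide var_def [symmetric])
  have Yle: "\<bar>Y a\<bar> \<le> B / s" if "a \<in> set_pmf p" for a
    using abs_centred_le [OF that] s by (simp add: Y_def divide_right_mono)
  have "cmod (\<phi> - (1 - t\<^sup>2 * (1 / real m) / 2))
      \<le> t\<^sup>2 / 6 * measure_pmf.expectation p (\<lambda>a. min (6 * (Y a)\<^sup>2) (\<bar>t\<bar> * \<bar>Y a\<bar> ^ 3))"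
    unfolding \<phi>_def using Y0 Y2
    by (intro prob_space.char_approx3' [OF measure_pmf.prob_space_axioms]) auto
  also have "measure_pmf.expectation p (\<lambda>a. min (6 * (Y a)\<^sup>2) (\<bar>t\<bar> * \<bar>Y a\<bar> ^ 3))
      \<le> measure_pmf.expectation p (\<lambda>a. \<bar>t\<bar> * (B / s) * (Y a)\<^sup>2)"
  proof (rule integral_mono_AE)
    show "AE a in p. min (6 * (Y a)\<^sup>2) (\<bar>t\<bar> * \<bar>Y a\<bar> ^ 3) \<le> \<bar>t\<bar> * (B / s) * (Y a)\<^sup>2"
    proof (simp only: AE_measure_pmf_iff, intro ballI)
      fix a assume a: "a \<in> set_pmf p"
      have "\<bar>t\<bar> * \<bar>Y a\<bar> ^ 3 = \<bar>t\<bar> * (\<bar>Y a\<bar> * (Y a)\<^sup>2)"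
        by (simp add: power2_eq_square power3_eq_cube flip: abs_mult)
      also have "\<dots> \<le> \<bar>t\<bar> * (B / s * (Y a)\<^sup>2)"
        using Yle [OF a] by (intro mult_left_mono mult_right_mono) auto
      finally show "min (6 * (Y a)\<^sup>2) (\<bar>t\<bar> * \<bar>Y a\<bar> ^ 3) \<le> \<bar>t\<bar> * (B / s) * (Y a)\<^sup>2"
        by (simp add: mult.assoc)
    qed
  qed simp_all
  also have "t\<^sup>2 / 6 * \<dots> = \<bar>t\<bar> ^ 3 / 6 * (B / s) / real m"
  proof -
    have "\<bar>t\<bar> ^ 3 = t\<^sup>2 * \<bar>t\<bar>"
      by (simp add: power3_eq_cube power2_eq_square flip: abs_mult)
    then show ?thesis by (simp add: Y2 mult_ac)
  qed
  finally have single: "cmod (\<phi> - complex_of_real (1 + (- (t\<^sup>2) / 2) / real m))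
      \<le> \<bar>t\<bar> ^ 3 / 6 * (B / s) / real m"
    by (simp add: mult_ac mult_right_mono)

  have "cmod (\<phi> ^ m - complex_of_real (1 + (- (t\<^sup>2) / 2) / real m) ^ m)
      \<le> real m * cmod (\<phi> - complex_of_real (1 + (- (t\<^sup>2) / 2) / real m))"
  proof (rule norm_power_diff)
    interpret real_distribution "distr p borel Y"
      by (rule prob_space.real_distribution_distr [OF measure_pmf.prob_space_axioms]) simp
    show "cmod \<phi> \<le> 1" unfolding \<phi>_def by (rule cmod_char_le_1)
    have "t\<^sup>2 / real m \<le> 4" using t m by (simp add: m_def divide_le_eq)
    then have "\<bar>1 + (- (t\<^sup>2) / 2) / real m\<bar> \<le> 1"
      by (simp add: abs_le_iff)
    then show "cmod (complex_of_real (1 + (- (t\<^sup>2) / 2) / real m)) \<le> 1"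
      by (simp only: norm_of_real)
  qed
  also have "\<dots> \<le> real m * (\<bar>t\<bar> ^ 3 / 6 * (B / s) / real m)"
    by (intro mult_left_mono single) simp
  also have "\<dots> = \<bar>t\<bar> ^ 3 / 6 * sqrt (B\<^sup>2 / (real m * var))"
    using m B by (simp add: s_def real_sqrt_divide)
  finally show ?thesis
    unfolding m_def [symmetric] s_def [symmetric] prod of_real_power .
qed

end

section \<open>Asymptotic normality of nondegenerate U-statistics\<close>

text \<open>The distribution, the kernel and its bound may all vary with \<open>m\<close>; only the order \<open>r\<close> is fixed.
  The same quantity \<open>B\<^sup>2 / (card A * var)\<close> controls both the remainder of the Hoeffding
  decomposition and the size of the single summands of \<open>L\<close>.\<close>

theorem subset_kernel_clt:
  fixes p :: "nat \<Rightarrow> 'b pmf" and d :: "nat \<Rightarrow> 'b" and A :: "nat \<Rightarrow> 'i set"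
    and h :: "nat \<Rightarrow> 'i set \<Rightarrow> ('i \<Rightarrow> 'b) \<Rightarrow> real" and g :: "nat \<Rightarrow> 'b \<Rightarrow> real" and B :: "nat \<Rightarrow> real"
  assumes kernel: "\<forall>\<^sub>F m in sequentially. subset_kernel (p m) (d m) (A m) r (h m) (g m) (B m)"
    and size: "filterlim (\<lambda>m. card (A m)) at_top sequentially"
    and nondegenerate: "\<forall>\<^sub>F m in sequentially. subset_kernel.var (p m) (g m) > 0"
    and negligible: "(\<lambda>m. (B m)\<^sup>2 / (real (card (A m)) * subset_kernel.var (p m) (g m))) \<longlonglongrightarrow> 0"
  shows "weak_conv_m (\<lambda>m. distr (Pi_pmf (A m) (d m) (\<lambda>_. p m)) borel
      (standardized (Pi_pmf (A m) (d m) (\<lambda>_. p m)) (subset_kernel.U (A m) r (h m))))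
    std_normal_distribution"
proof (rule levy_continuity)
  show "real_distribution std_normal_distribution" by (rule real_dist_normal_dist)
  let ?P = "\<lambda>m. Pi_pmf (A m) (d m) (\<lambda>_. p m)"
  let ?Z = "\<lambda>m. standardized (?P m) (subset_kernel.U (A m) r (h m))"
  show "real_distribution (distr (?P m) borel (?Z m))" for m
    by (rule prob_space.real_distribution_distr [OF measure_pmf.prob_space_axioms]) simp
  fix t :: real
  define \<rho> where "\<rho> m = (B m)\<^sup>2 / (real (card (A m)) * subset_kernel.var (p m) (g m))" for m
  define b where "b m = \<bar>t\<bar> * sqrt (real r ^ 4 * \<rho> m) + \<bar>t\<bar> ^ 3 / 6 * sqrt (\<rho> m)" for m
  define \<psi> where "\<psi> m = complex_of_real ((1 + (- (t\<^sup>2) / 2) / real m) ^ m)" for m :: nat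
  have "\<forall>\<^sub>F m in sequentially. t\<^sup>2 \<le> 4 * real (card (A m))"
  proof -
    have "\<forall>\<^sub>F m in sequentially. nat \<lceil>t\<^sup>2\<rceil> \<le> card (A m)"
      using size unfolding filterlim_at_top by blast
    then show ?thesis
      by eventually_elim linarith
  qed
  then have close: "\<forall>\<^sub>F m in sequentially.
      cmod (char (distr (?P m) borel (?Z m)) t - \<psi> (card (A m))) \<le> b m"
    using kernel nondegenerate
  proof eventually_elim
    case (elim m)
    interpret subset_kernel "p m" "d m" "A m" r "h m" "g m" "B m" by (rule elim(2))
    let ?L = "\<lambda>x. L x / sqrt (real (card (A m)) * var)"
    have "cmod (char (distr (?P m) borel (?Z m)) t - char (distr (?P m) borel ?L) t)
        \<le> \<bar>t\<bar> * sqrt (E (\<lambda>x. (?Z m x - ?L x)\<^sup>2))"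
      by (rule measure_pmf.cmod_char_diff_le) simp_all
    also have "\<dots> \<le> \<bar>t\<bar> * sqrt (real r ^ 4 * \<rho> m)"
      unfolding \<rho>_def
      by (intro mult_left_mono real_sqrt_le_mono standardized_U_close_to_L elim) simp
    finally have 1: "cmod (char (distr (?P m) borel (?Z m)) t - char (distr (?P m) borel ?L) t)
        \<le> \<bar>t\<bar> * sqrt (real r ^ 4 * \<rho> m)" .
    have 2: "cmod (char (distr (?P m) borel ?L) t - \<psi> (card (A m))) \<le> \<bar>t\<bar> ^ 3 / 6 * sqrt (\<rho> m)"
      unfolding \<psi>_def \<rho>_def by (rule char_L_approx [OF elim(3) elim(1)])
    show ?case
      unfolding b_def using norm_triangle_mono [OF 1 2] by simp
  qed
  have "(\<lambda>m. \<bar>t\<bar> * sqrt (real r ^ 4 * \<rho> m) + \<bar>t\<bar> ^ 3 / 6 * sqrt (\<rho> m))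
      \<longlonglongrightarrow> \<bar>t\<bar> * sqrt (real r ^ 4 * 0) + \<bar>t\<bar> ^ 3 / 6 * sqrt 0"
    using negligible unfolding \<rho>_def by (intro tendsto_intros)
  then have b: "b \<longlonglongrightarrow> 0" by (simp add: b_def [abs_def])
  have "\<psi> \<longlonglongrightarrow> complex_of_real (exp (- (t\<^sup>2) / 2))"
    unfolding \<psi>_def by (rule isCont_tendsto_compose [OF _ tendsto_exp_limit_sequentially]) auto
  then have "(\<lambda>m. \<psi> (card (A m))) \<longlonglongrightarrow> char std_normal_distribution t"
    using size by (subst char_std_normal_distribution) (rule filterlim_compose)
  then show "(\<lambda>m. char (distr (?P m) borel (?Z m)) t) \<longlonglongrightarrow> char std_normal_distribution t"
    by (rule Lim_transform) (rule Lim_null_comparison [OF close b])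
qed

section \<open>Transfer between probability spaces\<close>

text \<open>Independence and the marginals determine the joint law on the finite product space, and that space
  is discrete because the values are countable, so every \<open>F\<close> is measurable on it.\<close>

lemma distr_function_of_indep_vars_eq:
  fixes X :: "'i \<Rightarrow> 'a \<Rightarrow> 'c :: countable" and Y :: "'i \<Rightarrow> 'b \<Rightarrow> 'c" and F :: "('i \<Rightarrow> 'c) \<Rightarrow> real"
  assumes "prob_space M" "prob_space N" and J: "finite J" "J \<noteq> {}"
    and X: "prob_space.indep_vars M (\<lambda>_. count_space UNIV) X J"
    and Y: "prob_space.indep_vars N (\<lambda>_. count_space UNIV) Y J"
    and marginals: "\<And>i. i \<in> J \<Longrightarrow> distr M (count_space UNIV) (X i) = distr N (count_space UNIV) (Y i)"
    and F: "\<And>x y. (\<And>i. i \<in> J \<Longrightarrow> x i = y i) \<Longrightarrow> F x = F y"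
  shows "(\<lambda>\<omega>. F (\<lambda>i. X i \<omega>)) \<in> borel_measurable M"
    and "distr M borel (\<lambda>\<omega>. F (\<lambda>i. X i \<omega>)) = distr N borel (\<lambda>\<omega>. F (\<lambda>i. Y i \<omega>))"
proof -
  interpret M: prob_space M by fact
  interpret N: prob_space N by fact
  let ?S = "\<Pi>\<^sub>M i\<in>J. count_space (UNIV :: 'c set)"
  have X_rv [measurable]: "X i \<in> measurable M (count_space UNIV)" if "i \<in> J" for i
    using X that by (auto simp: M.indep_vars_def)
  have Y_rv [measurable]: "Y i \<in> measurable N (count_space UNIV)" if "i \<in> J" for i
    using Y that by (auto simp: N.indep_vars_def)
  have "?S = count_space (\<Pi>\<^sub>E i\<in>J. UNIV)"
    using J by (intro count_space_PiM_finite) auto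
  then have F_meas [measurable]: "F \<in> borel_measurable ?S"
    by simp
  have RX [measurable]: "(\<lambda>\<omega>. \<lambda>i\<in>J. X i \<omega>) \<in> measurable M ?S"
    by (rule measurable_restrict) (rule X_rv)
  have RY [measurable]: "(\<lambda>\<omega>. \<lambda>i\<in>J. Y i \<omega>) \<in> measurable N ?S"
    by (rule measurable_restrict) (rule Y_rv)
  have FX: "(\<lambda>\<omega>. F (\<lambda>i. X i \<omega>)) = F \<circ> (\<lambda>\<omega>. \<lambda>i\<in>J. X i \<omega>)"
    by (rule ext) (auto intro!: F)
  have FY: "(\<lambda>\<omega>. F (\<lambda>i. Y i \<omega>)) = F \<circ> (\<lambda>\<omega>. \<lambda>i\<in>J. Y i \<omega>)"
    by (rule ext) (auto intro!: F)
  show "(\<lambda>\<omega>. F (\<lambda>i. X i \<omega>)) \<in> borel_measurable M"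
    unfolding FX by (rule measurable_comp [OF RX F_meas])
  have "distr M ?S (\<lambda>\<omega>. \<lambda>i\<in>J. X i \<omega>) = (\<Pi>\<^sub>M i\<in>J. distr M (count_space UNIV) (X i))"
    by (rule M.indep_vars_iff_distr_eq_PiM' [THEN iffD1, OF J(2) X_rv X])
  also have "\<dots> = (\<Pi>\<^sub>M i\<in>J. distr N (count_space UNIV) (Y i))"
    by (intro PiM_cong refl marginals)
  also have "\<dots> = distr N ?S (\<lambda>\<omega>. \<lambda>i\<in>J. Y i \<omega>)"
    by (rule N.indep_vars_iff_distr_eq_PiM' [THEN iffD1, OF J(2) Y_rv Y, symmetric])
  finally have "distr (distr M ?S (\<lambda>\<omega>. \<lambda>i\<in>J. X i \<omega>)) borel F
      = distr (distr N ?S (\<lambda>\<omega>. \<lambda>i\<in>J. Y i \<omega>)) borel F"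
    by simp
  then show "distr M borel (\<lambda>\<omega>. F (\<lambda>i. X i \<omega>)) = distr N borel (\<lambda>\<omega>. F (\<lambda>i. Y i \<omega>))"
    unfolding FX FY by (simp add: distr_distr)
qed

lemma distr_standardized_cong:
  assumes [measurable]: "Z \<in> borel_measurable M" "Z' \<in> borel_measurable N"
    and eq: "distr M borel Z = distr N borel Z'"
  shows "distr M borel (standardized M Z) = distr N borel (standardized N Z')"
proof -
  have same: "integral\<^sup>L M (\<lambda>\<omega>. f (Z \<omega>)) = integral\<^sup>L N (\<lambda>\<omega>. f (Z' \<omega>))"
    if [measurable]: "f \<in> borel_measurable borel" for f :: "real \<Rightarrow> real"
    using integral_distr [of Z M borel f] integral_distr [of Z' N borel f] eq by simp
  define \<mu> where "\<mu> = integral\<^sup>L M Z"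
  define v where "v = integral\<^sup>L M (\<lambda>\<omega>. (Z \<omega> - \<mu>)\<^sup>2)"
  have "standardized M Z = (\<lambda>z. (z - \<mu>) / sqrt v) \<circ> Z"
    by (simp add: standardized_def [abs_def] o_def \<mu>_def v_def)
  moreover have "standardized N Z' = (\<lambda>z. (z - \<mu>) / sqrt v) \<circ> Z'"
    using same [of "\<lambda>z. z"] same [of "\<lambda>z. (z - \<mu>)\<^sup>2"]
    by (simp add: standardized_def [abs_def] o_def \<mu>_def v_def)
  moreover have "distr (distr M borel Z) borel (\<lambda>z. (z - \<mu>) / sqrt v)
      = distr (distr N borel Z') borel (\<lambda>z. (z - \<mu>) / sqrt v)"
    by (simp add: eq)
  ultimately show ?thesis
    by (simp add: distr_distr)
qed

lemma weak_conv_m_eventually_cong: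
  assumes conv: "weak_conv_m \<mu> \<nu>" and eq: "\<forall>\<^sub>F m in sequentially. \<mu>' m = \<mu> m"
  shows "weak_conv_m \<mu>' \<nu>"
  unfolding weak_conv_m_def weak_conv_def
proof (intro allI impI)
  fix x assume "isCont (cdf \<nu>) x"
  then have lim: "(\<lambda>m. cdf (\<mu> m) x) \<longlonglongrightarrow> cdf \<nu> x"
    using conv by (simp add: weak_conv_m_def weak_conv_def)
  have "\<forall>\<^sub>F m in sequentially. cdf (\<mu> m) x = cdf (\<mu>' m) x"
    using eq by eventually_elim simp
  with lim show "(\<lambda>m. cdf (\<mu>' m) x) \<longlonglongrightarrow> cdf \<nu> x"
    by (rule Lim_transform_eventually)
qed

section \<open>The gcd kernel and the variance of its projection\<close>

definition gcd_kernel :: "nat \<Rightarrow> nat set \<Rightarrow> (nat \<Rightarrow> nat) \<Rightarrow> real" where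
  "gcd_kernel q I x = real (GCD i\<in>I. x i) ^ q"

text \<open>The conditional mean of the kernel, written over the fixed index set \<open>{1..<r}\<close> of size \<open>r - 1\<close> so
  that it visibly depends neither on the subset nor on the number of variables.\<close>
definition gcd_projection :: "nat \<Rightarrow> nat \<Rightarrow> nat \<Rightarrow> nat \<Rightarrow> real" where
  "gcd_projection r q n a = measure_pmf.expectation (Pi_pmf {1..<r} 0 (\<lambda>_. pmf_of_set {1..n}))
     (\<lambda>x. real (gcd a (GCD i\<in>{1..<r}. x i)) ^ q)"

lemma subset_kernel_gcd:
  assumes "n \<ge> 1" "2 \<le> r" "r \<le> m"
  shows "subset_kernel (pmf_of_set {1..n}) 0 {1..m} r (gcd_kernel q) (gcd_projection r q n) (real n ^ q)"
proof
  have set: "set_pmf (pmf_of_set {1..n}) = {1..n}" using assms by (intro set_pmf_of_set) auto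
  show "finite {1..m}" "2 \<le> r" "r \<le> card {1..m}" using assms by auto
  show "finite (set_pmf (pmf_of_set {1..n}))" using set by simp
  show "gcd_kernel q I x = gcd_kernel q I y" if "\<And>i. i \<in> I \<Longrightarrow> x i = y i" for I x y
  proof -
    have "x ` I = y ` I" using that by (rule image_cong [OF refl])
    then show ?thesis by (simp add: gcd_kernel_def)
  qed
  show "gcd_kernel q I x \<in> {0..real n ^ q}"
    if I: "I \<subseteq> {1..m}" "card I = r" and x: "\<And>i. i \<in> {1..m} \<Longrightarrow> x i \<in> set_pmf (pmf_of_set {1..n})" for I x
  proof -
    obtain i where "i \<in> I" using I assms by fastforce
    then have "(GCD i\<in>I. x i) dvd x i" by (intro Gcd_dvd) auto
    moreover have "x i \<in> {1..n}" using x [of i] I \<open>i \<in> I\<close> set by auto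
    ultimately have "(GCD i\<in>I. x i) \<le> n" by (metis atLeastAtMost_iff dvd_imp_le le_trans less_le_trans zero_less_one)
    then show ?thesis by (simp add: gcd_kernel_def power_mono)
  qed
  fix I i a assume I: "I \<subseteq> {1..m}" "card I = r" "i \<in> I"
  let ?P = "\<lambda>K. Pi_pmf K 0 (\<lambda>_. pmf_of_set {1..n})"
  \<comment> \<open>the other \<open>r - 1\<close> coordinates are relabelled by \<open>{1..<r}\<close>; off \<open>K\<close> the relabelling takes the
    value \<open>0\<close>, outside \<open>{1..<r}\<close>, so that default values are sent to default values\<close>
  define K where "K = I - {i}"
  have K: "K \<subseteq> {1..m}" "finite K" "card K = card {1..<r}"
    using I assms finite_subset [of I "{1..m}"] by (auto simp: K_def)
  then obtain \<pi> where \<pi>: "bij_betw \<pi> K {1..<r}"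
    using finite_same_card_bij [of K "{1..<r}"] by auto
  define \<pi>' where "\<pi>' k = (if k \<in> K then \<pi> k else 0)" for k
  have \<pi>': "bij_betw \<pi>' K {1..<r}"
    using \<pi> by (rule bij_betw_cong [THEN iffD1, rotated]) (simp add: \<pi>'_def)
  have "?P K = map_pmf (\<lambda>x. x \<circ> \<pi>') (?P {1..<r})"
    using K \<pi>' by (intro Pi_pmf_bij_betw) (auto simp: \<pi>'_def)
  moreover have "?P K = map_pmf (\<lambda>x k. if k \<in> K then x k else 0) (?P {1..m})"
    using K by (intro Pi_pmf_subset) auto
  ultimately have maps: "map_pmf (\<lambda>x k. if k \<in> K then x k else 0) (?P {1..m}) = map_pmf (\<lambda>x. x \<circ> \<pi>') (?P {1..<r})"
    by simp
  have law: "measure_pmf.expectation (?P {1..m}) (\<lambda>x. f (\<lambda>k. if k \<in> K then x k else 0))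
      = measure_pmf.expectation (?P {1..<r}) (\<lambda>x. f (x \<circ> \<pi>'))" for f :: "_ \<Rightarrow> real"
    using arg_cong [OF maps, of "\<lambda>Q. measure_pmf.expectation Q f"] by (simp only: integral_map_pmf)
  have "gcd_kernel q I (x(i := a)) = real (gcd a (GCD k\<in>K. if k \<in> K then x k else 0)) ^ q" for x :: "nat \<Rightarrow> nat"
  proof -
    have "(x(i := a)) ` I = insert a ((\<lambda>k. if k \<in> K then x k else 0) ` K)"
      using I(3) by (auto simp: K_def)
    then show ?thesis by (simp add: gcd_kernel_def del: fun_upd_apply)
  qed
  moreover have "(GCD k\<in>K. (x \<circ> \<pi>') k) = (GCD k\<in>{1..<r}. x k)" for x :: "nat \<Rightarrow> nat"
    using \<pi>' by (simp only: image_comp [symmetric] bij_betw_imp_surj_on)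
  ultimately show "measure_pmf.expectation (?P {1..m}) (\<lambda>x. gcd_kernel q I (x(i := a))) = gcd_projection r q n a"
    using law [of "\<lambda>x. real (gcd a (GCD k\<in>K. x k)) ^ q"] by (simp only: gcd_projection_def)
qed

text \<open>The value \<open>1 / 3\<close> is attained for \<open>n = 3\<close>.\<close>

lemma prob_uniform_even_ge:
  fixes n :: nat
  assumes "n \<ge> 2"
  shows "measure_pmf.prob (pmf_of_set {1..n}) {b. even b} \<ge> 1 / 3"
proof -
  have "(\<lambda>k. 2 * k) ` {1..n div 2} \<subseteq> {1..n} \<inter> {b. even b}"
    by (auto simp: Suc_le_eq)
  then have "card ((\<lambda>k. 2 * k) ` {1..n div 2}) \<le> card ({1..n} \<inter> {b. even b})"
    by (intro card_mono) auto
  moreover have "card ((\<lambda>k :: nat. 2 * k) ` {1..n div 2}) = n div 2"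
    by (subst card_image) (auto simp: inj_on_def)
  ultimately have "n div 2 \<le> card ({1..n} \<inter> {b. even b})" by simp
  moreover have "n \<le> 3 * (n div 2)" using assms by presburger
  ultimately have "real n \<le> 3 * real (card ({1..n} \<inter> {b. even b}))" by linarith
  then show ?thesis using assms by (simp add: measure_pmf_of_set field_simps)
qed

text \<open>For odd \<open>a\<close> the gcd with \<open>a\<close> is odd, while the gcd with \<open>2 a\<close> is a multiple of it that is even
  once all other variables are even, so on this event the gcd strictly increases.\<close>

lemma gcd_projection_double:
  assumes "n \<ge> 2" "q \<ge> 1" "odd a" "a \<ge> 1"
  shows "gcd_projection r q n a + (1 / 3) ^ (r - 1) \<le> gcd_projection r q n (2 * a)"
proof -
  let ?P = "Pi_pmf {1..<r} 0 (\<lambda>_. pmf_of_set {1..n})"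
  let ?Ev = "Pi {1..<r} (\<lambda>_. {b :: nat. even b})"
  have "finite (set_pmf ?P)"
    using assms by (intro finite_set_Pi_pmf) (auto simp: set_pmf_of_set)
  then have int: "integrable ?P f" for f :: "_ \<Rightarrow> real"
    by (rule integrable_measure_pmf_finite)
  have "(1 / 3) ^ (r - 1) = (\<Prod>i\<in>{1..<r}. 1 / 3 :: real)" by simp
  also have "\<dots> \<le> (\<Prod>i\<in>{1..<r}. measure_pmf.prob (pmf_of_set {1..n}) {b. even b})"
    using prob_uniform_even_ge [OF assms(1)] by (intro prod_mono) auto
  also have "\<dots> = measure_pmf.prob ?P ?Ev"
    by (rule measure_Pi_pmf_Pi [symmetric]) simp
  also have "\<dots> = measure_pmf.expectation ?P (indicator ?Ev)" by simp
  finally have even: "(1 / 3 :: real) ^ (r - 1) \<le> measure_pmf.expectation ?P (indicator ?Ev)" .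
  have "gcd_projection r q n a + (1 / 3) ^ (r - 1)
      \<le> measure_pmf.expectation ?P (\<lambda>x. real (gcd a (GCD i\<in>{1..<r}. x i)) ^ q + indicator ?Ev x)"
    using even by (subst Bochner_Integration.integral_add) (simp_all only: int gcd_projection_def add_left_mono)
  also have "\<dots> \<le> gcd_projection r q n (2 * a)"
    unfolding gcd_projection_def
  proof (rule integral_mono)
    fix x :: "nat \<Rightarrow> nat"
    define e where "e = (GCD i\<in>{1..<r}. x i)"
    have dvd: "gcd a e dvd gcd (2 * a) e" by (simp add: gcd_dvdI1)
    have pos: "gcd (2 * a) e > 0" using assms by simp
    have "real (gcd a e) ^ q + indicator ?Ev x \<le> real (gcd (2 * a) e) ^ q"
    proof (cases "x \<in> ?Ev")
      case True
      then have "2 dvd e" unfolding e_def by (intro Gcd_greatest) (auto simp: Pi_iff)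
      then have "even (gcd (2 * a) e)" by simp
      moreover have "odd (gcd a e)" using \<open>odd a\<close> by (meson dvd_trans gcd_dvd1)
      ultimately have "gcd a e \<noteq> gcd (2 * a) e" by metis
      then have "gcd a e < gcd (2 * a) e" using dvd_imp_le [OF dvd pos] by simp
      then have "gcd a e ^ q < gcd (2 * a) e ^ q" using assms by (intro power_strict_mono) auto
      then have "gcd a e ^ q + 1 \<le> gcd (2 * a) e ^ q" by simp
      then have "real (gcd a e ^ q + 1) \<le> real (gcd (2 * a) e ^ q)" by (rule of_nat_mono)
      then show ?thesis using True by simp
    next
      case False
      then show ?thesis using dvd_imp_le [OF dvd pos] by (simp add: power_mono)
    qed
    then show "real (gcd a (GCD i\<in>{1..<r}. x i)) ^ q + indicator ?Ev x
        \<le> real (gcd (2 * a) (GCD i\<in>{1..<r}. x i)) ^ q"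
      by (simp add: e_def)
  qed (rule int)+
  finally show ?thesis .
qed

text \<open>The pairs \<open>{a, 2 a}\<close> with \<open>a\<close> odd and \<open>2 a \<le> n\<close> are disjoint, there are at least \<open>n / 6\<close> of
  them, and each contributes at least \<open>\<delta>\<^sup>2 / 2\<close> to the sum of squared deviations from any \<open>c\<close>.\<close>

lemma uniform_variance_ge_of_doubling_gap:
  fixes g :: "nat \<Rightarrow> real"
  assumes n: "n \<ge> 2" and "\<delta> \<ge> 0" and gap: "\<And>a. odd a \<Longrightarrow> g a + \<delta> \<le> g (2 * a)"
  shows "measure_pmf.expectation (pmf_of_set {1..n}) (\<lambda>a. (g a - c)\<^sup>2) \<ge> \<delta>\<^sup>2 / 12"
proof -
  \<comment> \<open>the number of odd \<open>a\<close> with \<open>2 a \<le> n\<close>\<close>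
  define N where "N = (n div 2 + 1) div 2"
  define s where "s a = (g a - c)\<^sup>2" for a
  have "real n * (\<delta>\<^sup>2 / 12) \<le> real N * (\<delta>\<^sup>2 / 2)"
  proof -
    have "n \<le> 6 * N" using n unfolding N_def by presburger
    then have "real n \<le> 6 * real N" by linarith
    then have "real n * (\<delta>\<^sup>2 / 12) \<le> 6 * real N * (\<delta>\<^sup>2 / 12)" by (intro mult_right_mono) auto
    then show ?thesis by simp
  qed
  also have "\<dots> = (\<Sum>k<N. \<delta>\<^sup>2 / 2)" by simp
  also have "\<dots> \<le> (\<Sum>k<N. s (2 * k + 1) + s (2 * (2 * k + 1)))"
  proof (rule sum_mono)
    fix k
    define u v where "u = g (2 * k + 1) - c" and "v = g (2 * (2 * k + 1)) - c"
    have "\<delta> \<le> v - u" using gap [of "2 * k + 1"] by (simp add: u_def v_def)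
    then have "\<delta>\<^sup>2 \<le> (v - u)\<^sup>2" using \<open>\<delta> \<ge> 0\<close> by (rule power_mono)
    also have "\<dots> \<le> (v - u)\<^sup>2 + (v + u)\<^sup>2" by simp
    also have "\<dots> = 2 * (u\<^sup>2 + v\<^sup>2)" by (simp add: power2_eq_square algebra_simps)
    finally show "\<delta>\<^sup>2 / 2 \<le> s (2 * k + 1) + s (2 * (2 * k + 1))"
      by (simp add: s_def u_def v_def)
  qed
  also have "\<dots> = sum s ((\<lambda>k. 2 * k + 1) ` {..<N}) + sum s ((\<lambda>k. 2 * (2 * k + 1)) ` {..<N})"
    by (simp add: sum.distrib sum.reindex inj_on_def)
  also have "\<dots> = sum s ((\<lambda>k. 2 * k + 1) ` {..<N} \<union> (\<lambda>k. 2 * (2 * k + 1)) ` {..<N})"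
    by (rule sum.union_disjoint [symmetric]) (auto, presburger)
  also have "\<dots> \<le> sum s {1..n}"
    by (rule sum_mono2) (auto simp: s_def N_def)
  finally have "\<delta>\<^sup>2 / 12 \<le> sum s {1..n} / real n"
    using n by (simp add: field_simps)
  moreover have "measure_pmf.expectation (pmf_of_set {1..n}) s = sum s {1..n} / real n"
    using n by (subst integral_pmf_of_set) auto
  ultimately show ?thesis
    by (simp add: s_def [abs_def])
qed

section \<open>Asymptotic normality of gcd sums\<close>

theorem theorem6p2:
  fixes M :: "nat \<Rightarrow> 'a measure"
    and X :: "nat \<Rightarrow> nat \<Rightarrow> 'a \<Rightarrow> nat"
    and r q :: nat
    and \<beta> :: real
    and n :: "nat \<Rightarrow> nat"
  assumes X: "\<And>k. k \<ge> 1 \<Longrightarrow> iid_uniform (M k) k (X k)"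
    and "r \<ge> 2" and "q \<ge> 1" and "q \<le> r - 1"
    and "\<beta> < 1 / 2"
    and "\<And>m. m \<ge> r \<Longrightarrow> n m \<ge> 2"
    and "\<forall>\<^sub>F m in sequentially. real (n m) ^ q \<le> real m powr \<beta>"
  shows "weak_conv_m
           (\<lambda>m. distr (M (n m)) borel (standardized (M (n m)) (gcd_sum r q (X (n m)) m)))
           std_normal_distribution"
proof -
  let ?p = "\<lambda>m. pmf_of_set {1..n m}"
  let ?P = "\<lambda>m. Pi_pmf {1..m} 0 (\<lambda>_. ?p m)"
  let ?U = "\<lambda>m. subset_kernel.U {1..m} r (gcd_kernel q)"
  let ?g = "\<lambda>m. gcd_projection r q (n m)"
  let ?var = "\<lambda>m. subset_kernel.var (?p m) (?g m)"
  define c :: real where "c = ((1 / 3) ^ (r - 1))\<^sup>2 / 12"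
  have c: "c > 0" by (simp add: c_def)
  have kernel: "subset_kernel (?p m) 0 {1..m} r (gcd_kernel q) (?g m) (real (n m) ^ q)" if "m \<ge> r" for m
    using assms(6) [OF that] assms(2) that by (intro subset_kernel_gcd) auto
  have var: "?var m \<ge> c" if "m \<ge> r" for m
  proof -
    interpret subset_kernel "?p m" 0 "{1..m}" r "gcd_kernel q" "?g m" "real (n m) ^ q"
      by (rule kernel [OF that])
    show ?thesis
      unfolding var_def c_def
    proof (rule uniform_variance_ge_of_doubling_gap)
      show "?g m a + (1 / 3) ^ (r - 1) \<le> ?g m (2 * a)" if "odd a" for a
        using assms(3) assms(6) [OF \<open>m \<ge> r\<close>] that odd_pos [OF that]
        by (intro gcd_projection_double) auto
    qed (use assms(6) [OF that] in auto)
  qed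
  have eventually_r: "\<forall>\<^sub>F m in sequentially. m \<ge> r" by (rule eventually_ge_at_top)

  have "weak_conv_m (\<lambda>m. distr (?P m) borel (standardized (?P m) (?U m))) std_normal_distribution"
  proof (rule subset_kernel_clt)
    show "\<forall>\<^sub>F m in sequentially.
        subset_kernel (?p m) 0 {1..m} r (gcd_kernel q) (?g m) (real (n m) ^ q)"
      using eventually_r by eventually_elim (rule kernel)
    show "filterlim (\<lambda>m. card {1..m}) at_top sequentially" by (simp add: filterlim_ident)
    show "\<forall>\<^sub>F m in sequentially. ?var m > 0"
      using eventually_r by eventually_elim (use var c in force)
    show "(\<lambda>m. (real (n m) ^ q)\<^sup>2 / (real (card {1..m}) * ?var m)) \<longlonglongrightarrow> 0"
    proof (rule Lim_null_comparison)
      show "\<forall>\<^sub>F m in sequentially. norm ((real (n m) ^ q)\<^sup>2 / (real (card {1..m}) * ?var m))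
          \<le> 1 / c * real m powr (2 * \<beta> - 1)"
        using eventually_r assms(7)
      proof eventually_elim
        case (elim m)
        have m: "real m > 0" using elim assms(2) by simp
        have "(real (n m) ^ q)\<^sup>2 / (real m * ?var m) \<le> (real m powr \<beta>)\<^sup>2 / (real m * c)"
          using elim(2) var [OF elim(1)] c m by (intro frac_le power_mono mult_left_mono) auto
        also have "\<dots> = 1 / c * real m powr (2 * \<beta> - 1)"
          using m c by (simp add: powr_diff power2_eq_square flip: powr_add)
        finally show ?case using var [OF elim(1)] c by simp
      qed
      have "(\<lambda>m. real m powr (2 * \<beta> - 1)) \<longlonglongrightarrow> 0"
        using assms(5) by (intro tendsto_neg_powr filterlim_real_sequentially) auto
      then show "(\<lambda>m. 1 / c * real m powr (2 * \<beta> - 1)) \<longlonglongrightarrow> 0"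
        by (rule tendsto_mult_right_zero)
    qed
  qed
  then show ?thesis
  proof (rule weak_conv_m_eventually_cong)
    show "\<forall>\<^sub>F m in sequentially.
        distr (M (n m)) borel (standardized (M (n m)) (gcd_sum r q (X (n m)) m))
        = distr (?P m) borel (standardized (?P m) (?U m))"
      using eventually_r
    proof eventually_elim
      case (elim m)
      interpret subset_kernel "?p m" 0 "{1..m}" r "gcd_kernel q" "?g m" "real (n m) ^ q"
        by (rule kernel [OF elim])
      have iid: "iid_uniform (M (n m)) (n m) (X (n m))"
        using assms(6) [OF elim] by (intro X) simp
      then interpret prob_space "M (n m)" by (simp add: iid_uniform_def)
      have sum: "gcd_sum r q (X (n m)) m = (\<lambda>\<omega>. U (\<lambda>i. X (n m) i \<omega>))"
        by (rule ext) (simp only: gcd_sum_def U_def gcd_kernel_def)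
      have local: "U x = U y" if "\<And>i. i \<in> {1..m} \<Longrightarrow> x i = y i" for x y
        unfolding U_def using that by (intro sum.cong refl h_local) auto
      have indep: "indep_vars (\<lambda>_. count_space UNIV) (X (n m)) {1..m}"
        using iid indep_vars_subset [of "\<lambda>_. count_space UNIV" "X (n m)" "{1..}" "{1..m}"]
        by (auto simp: iid_uniform_def)
      have marginal: "distr (M (n m)) (count_space UNIV) (X (n m) i)
          = distr (?P m) (count_space UNIV) (\<lambda>x. x i)" if "i \<in> {1..m}" for i
      proof -
        have "distr (M (n m)) (count_space UNIV) (X (n m) i) = measure_pmf (?p m)"
          using iid that by (simp add: iid_uniform_def)
        also have "\<dots> = measure_pmf (map_pmf (\<lambda>x. x i) (?P m))"
          using that by (simp add: Pi_pmf_component)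
        finally show ?thesis by (simp add: map_pmf_rep_eq)
      qed
      note transfer = distr_function_of_indep_vars_eq [where F = U, OF prob_space_axioms
          measure_pmf.prob_space_axioms _ _ indep indep_vars_Pi_pmf marginal local]
      have "{1..m} \<noteq> {}" using elim assms(2) by auto
      then show ?case
        unfolding sum by (intro distr_standardized_cong transfer) auto
    qed
  qed
qed

end
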